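(* Let $X$ be a geodesic metric space (in particular connected), with a Lipschitz locally convex median $\mu$ of rank $r$. Then there exists a median, biLipschitz embedding of the $r$-cube $[0,1]^r$ into $X$ with convex image.
   Context: A median on a set $X$ is a map $\mu:X^3\to X$ such that for all $a,b,c,d,e\in X$: $\mu(a,b,c)=\mu(b,a,c)=\mu(b,c,a)$; $\mu(a,a,b)=a$; and $\mu(a,b,\mu(c,d,e))=\mu(\mu(a,b,c),\mu(a,b,d),e)$. The interval between $a,b$ is $I(a,b)=\{c\in X : \mu(a,b,c)=c\}$; a subset $C\subset X$ is convex if $I(a,b)\subset C$ for all $a,b\in C$. A map $f$ between median algebras is median if it commutes with the medians; an injective median map is a median embedding. The cubes $\{0,1\}^n$ and $[0,1]^n$ carry the product medians (coordinatewise the usual betweenness median, i.e. middle value, on $\{0,1\}$ and $[0,1]$). The rank of a median is the largest $n$ such that there is a median embedding $\{0,1\}^n\to X$. If $(X,d)$ is a metric space, a median $\mu$ on $X$ is Lipschitz if there is $k\in[0,+\infty)$ such that $d(\mu(a,b,c),\mu(a',b',c'))\leq k(d(a,a')+d(b,b')+d(c,c'))$ for all $a,b,c,a',b',c'\in X$; it is locally convex if each point of $X$ has a basis of neighbourhoods consisting of convex subsets of $X$. *)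

theory Defs
  imports "HOL-Analysis.Analysis"
begin

definition median_on :: "'a set \<Rightarrow> ('a \<Rightarrow> 'a \<Rightarrow> 'a \<Rightarrow> 'a) \<Rightarrow> bool" where
  "median_on X \<mu> \<longleftrightarrow>
     (\<forall>a\<in>X. \<forall>b\<in>X. \<forall>c\<in>X. \<mu> a b c \<in> X) \<and>
     (\<forall>a\<in>X. \<forall>b\<in>X. \<forall>c\<in>X. \<mu> a b c = \<mu> b a c \<and> \<mu> b a c = \<mu> b c a) \<and>
     (\<forall>a\<in>X. \<forall>b\<in>X. \<mu> a a b = a) \<and>
     (\<forall>a\<in>X. \<forall>b\<in>X. \<forall>c\<in>X. \<forall>d\<in>X. \<forall>e\<in>X. \<mu> a b (\<mu> c d e) = \<mu> (\<mu> a b c) (\<mu> a b d) e)"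

definition median_interval ::
  "'a set \<Rightarrow> ('a \<Rightarrow> 'a \<Rightarrow> 'a \<Rightarrow> 'a) \<Rightarrow> 'a \<Rightarrow> 'a \<Rightarrow> 'a set" where
  "median_interval X \<mu> a b = {c \<in> X. \<mu> a b c = c}"

definition median_convex :: "'a set \<Rightarrow> ('a \<Rightarrow> 'a \<Rightarrow> 'a \<Rightarrow> 'a) \<Rightarrow> 'a set \<Rightarrow> bool" where
  "median_convex X \<mu> C \<longleftrightarrow> C \<subseteq> X \<and> (\<forall>a\<in>C. \<forall>b\<in>C. median_interval X \<mu> a b \<subseteq> C)"

definition median_map ::
  "'a set \<Rightarrow> ('a \<Rightarrow> 'a \<Rightarrow> 'a \<Rightarrow> 'a) \<Rightarrow> 'b set \<Rightarrow> ('b \<Rightarrow> 'b \<Rightarrow> 'b \<Rightarrow> 'b) \<Rightarrow> ('a \<Rightarrow> 'b) \<Rightarrow> bool" where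
  "median_map X \<mu> Y \<nu> f \<longleftrightarrow>
     f \<in> X \<rightarrow> Y \<and> (\<forall>a\<in>X. \<forall>b\<in>X. \<forall>c\<in>X. f (\<mu> a b c) = \<nu> (f a) (f b) (f c))"

definition median_embedding ::
  "'a set \<Rightarrow> ('a \<Rightarrow> 'a \<Rightarrow> 'a \<Rightarrow> 'a) \<Rightarrow> 'b set \<Rightarrow> ('b \<Rightarrow> 'b \<Rightarrow> 'b \<Rightarrow> 'b) \<Rightarrow> ('a \<Rightarrow> 'b) \<Rightarrow> bool" where
  "median_embedding X \<mu> Y \<nu> f \<longleftrightarrow> median_map X \<mu> Y \<nu> f \<and> inj_on f X"

text \<open>Points of an n-cube are extensional functions on \<open>{..<n}\<close>, so that the dimension (possibly 0,
  giving a single point) can be quantified over.\<close>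

definition discrete_cube :: "nat \<Rightarrow> (nat \<Rightarrow> real) set" where
  "discrete_cube n = ({..<n} \<rightarrow>\<^sub>E {0, 1})"

definition unit_cube :: "nat \<Rightarrow> (nat \<Rightarrow> real) set" where
  "unit_cube n = ({..<n} \<rightarrow>\<^sub>E {0..1})"

definition middle :: "'a::linorder \<Rightarrow> 'a \<Rightarrow> 'a \<Rightarrow> 'a" where
  "middle a b c = max (min a b) (min (max a b) c)"

definition cube_median ::
  "nat \<Rightarrow> (nat \<Rightarrow> real) \<Rightarrow> (nat \<Rightarrow> real) \<Rightarrow> (nat \<Rightarrow> real) \<Rightarrow> (nat \<Rightarrow> real)" where
  "cube_median n x y z = (\<lambda>i\<in>{..<n}. middle (x i) (y i) (z i))"

text \<open>The Euclidean distance on the cube; the library's \<open>dist\<close> on functions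
  is a different metric.\<close>

definition cube_dist :: "nat \<Rightarrow> (nat \<Rightarrow> real) \<Rightarrow> (nat \<Rightarrow> real) \<Rightarrow> real" where
  "cube_dist n x y = L2_set (\<lambda>i. dist (x i) (y i)) {..<n}"

text \<open>A relation rather than a function, since the rank may be infinite; \<open>median_rank X \<mu> r\<close> says
  that it is finite and equal to \<open>r\<close>.\<close>

definition median_rank :: "'a set \<Rightarrow> ('a \<Rightarrow> 'a \<Rightarrow> 'a \<Rightarrow> 'a) \<Rightarrow> nat \<Rightarrow> bool" where
  "median_rank X \<mu> r \<longleftrightarrow>
     (\<exists>f. median_embedding (discrete_cube r) (cube_median r) X \<mu> f) \<and>
     (\<forall>n f. median_embedding (discrete_cube n) (cube_median n) X \<mu> f \<longrightarrow> n \<le> r)"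

definition geodesic_set :: "'a::metric_space set \<Rightarrow> bool" where
  "geodesic_set X \<longleftrightarrow>
     (\<forall>x\<in>X. \<forall>y\<in>X. \<exists>g. g \<in> {0..dist x y} \<rightarrow> X \<and> g 0 = x \<and> g (dist x y) = y \<and>
        (\<forall>s\<in>{0..dist x y}. \<forall>t\<in>{0..dist x y}. dist (g s) (g t) = \<bar>s - t\<bar>))"

definition Lipschitz_median ::
  "'a::metric_space set \<Rightarrow> ('a \<Rightarrow> 'a \<Rightarrow> 'a \<Rightarrow> 'a) \<Rightarrow> bool" where
  "Lipschitz_median X \<mu> \<longleftrightarrow>
     (\<exists>k\<ge>0. \<forall>a\<in>X. \<forall>b\<in>X. \<forall>c\<in>X. \<forall>a'\<in>X. \<forall>b'\<in>X. \<forall>c'\<in>X.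
        dist (\<mu> a b c) (\<mu> a' b' c') \<le> k * (dist a a' + dist b b' + dist c c'))"

definition locally_convex_median ::
  "'a::metric_space set \<Rightarrow> ('a \<Rightarrow> 'a \<Rightarrow> 'a \<Rightarrow> 'a) \<Rightarrow> bool" where
  "locally_convex_median X \<mu> \<longleftrightarrow> neighbourhood_base_of (median_convex X \<mu>) (top_of_set X)"

definition biLipschitz_on ::
  "'a set \<Rightarrow> ('a \<Rightarrow> 'a \<Rightarrow> real) \<Rightarrow> ('b \<Rightarrow> 'b \<Rightarrow> real) \<Rightarrow> ('a \<Rightarrow> 'b) \<Rightarrow> bool" where
  "biLipschitz_on X dX dY f \<longleftrightarrow>
     (\<exists>K\<ge>1. \<forall>x\<in>X. \<forall>y\<in>X. dX x y / K \<le> dY (f x) (f y) \<and> dY (f x) (f y) \<le> K * dX x y)"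

lemma middle_eq_clamp: "a \<le> b \<Longrightarrow> middle a b c = max a (min b c)"
  by (simp add: middle_def)

lemma middle_commute: "middle a b c = middle b a c" "middle b a c = middle b c a"
  by (auto simp: middle_def min_def max_def)

lemma middle_assoc:
  "middle a b (middle c d e) = middle (middle a b c) (middle a b d) e"
proof -
  have *: "middle a b (middle c d e) = middle (middle a b c) (middle a b d) e"
    if "a \<le> b" "c \<le> d" for a b c d
  proof -
    have "max a (min b c) \<le> max a (min b d)"
      using that by (meson max.mono min.mono order_refl)
    with that show ?thesis
      by (simp add: middle_eq_clamp) (auto simp: min_def max_def)
  qed
  show ?thesis
    using *[of a b c d] *[of b a c d] *[of a b d c] *[of b a d c] linear[of a b] linear[of c d]
    by (metis middle_commute(1))
qed

lemma median_on_middle: "median_on A middle"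
  unfolding median_on_def
proof (intro conjI ballI)
  fix a b c d e
  assume "a \<in> A" "b \<in> A" "c \<in> A"
  then show "middle a b c \<in> A"
    by (simp add: middle_def min_def max_def)
  show "middle a b c = middle b a c" "middle b a c = middle b c a"
    by (fact middle_commute)+
  show "middle a a b = a"
    by (simp add: middle_def)
  show "middle a b (middle c d e) = middle (middle a b c) (middle a b d) e"
    by (fact middle_assoc)
qed

lemma median_on_cube: "median_on ({..<n} \<rightarrow>\<^sub>E A) (cube_median n)"
  unfolding median_on_def
proof (intro conjI ballI)
  fix x y z u v
  assume xyz: "x \<in> {..<n} \<rightarrow>\<^sub>E A" "y \<in> {..<n} \<rightarrow>\<^sub>E A" "z \<in> {..<n} \<rightarrow>\<^sub>E A"
  then show "cube_median n x y z \<in> {..<n} \<rightarrow>\<^sub>E A"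
    using median_on_middle[of A] by (simp add: cube_median_def median_on_def PiE_iff)
  show "cube_median n x y z = cube_median n y x z"
    unfolding cube_median_def by (rule restrict_ext) (rule middle_commute)
  show "cube_median n y x z = cube_median n y z x"
    unfolding cube_median_def by (rule restrict_ext) (rule middle_commute)
  show "cube_median n x y (cube_median n z u v)
      = cube_median n (cube_median n x y z) (cube_median n x y u) v"
    unfolding cube_median_def by (rule restrict_ext) (simp add: middle_assoc)
next
  fix x y assume "x \<in> {..<n} \<rightarrow>\<^sub>E A"
  then show "cube_median n x x y = x"
    by (auto simp: cube_median_def middle_def fun_eq_iff PiE_iff extensional_def)
qed

lemma median_on_unit_cube: "median_on (unit_cube n) (cube_median n)"
  unfolding unit_cube_def by (rule median_on_cube)

lemma median_on_discrete_cube: "median_on (discrete_cube n) (cube_median n)"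
  unfolding discrete_cube_def by (rule median_on_cube)

end

theory Submission
  imports Defs
begin

text \<open>Let \<open>a\<close> be a vertex of an embedded discrete \<open>r\<close>-cube, \<open>e i\<close> its neighbours and \<open>b\<close> the opposite
  vertex. In the distributive lattice \<open>I(a,b)\<close> the \<open>e i\<close> are the atoms of a Boolean subalgebra, so
  \<open>I(a,b)\<close> is the product of the intervals \<open>I(a,e i)\<close>; the coordinates are the Lipschitz maps
  \<open>\<mu> a (e i)\<close>, and their inverse is an iterated join, also Lipschitz. As the rank is \<open>r\<close>, each factor
  is a chain. A geodesic from \<open>x\<close> to \<open>y\<close> projects to a path onto the segment \<open>I(x,y)\<close> of such a chain,
  of length at most \<open>k\<close> times the distance of \<open>x\<close> and \<open>y\<close>, so arc length identifies the chain
  biLipschitzly with a real interval.\<close>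

section \<open>Median algebras: projections and intervals\<close>

locale median_algebra =
  fixes \<mu> :: "'a \<Rightarrow> 'a \<Rightarrow> 'a \<Rightarrow> 'a"
  assumes median: "median_on UNIV \<mu>"
begin

lemma swap12: "\<mu> x y z = \<mu> y x z"
  using median by (simp add: median_on_def)

lemma swap23: "\<mu> x y z = \<mu> x z y"
  using median unfolding median_on_def by (metis UNIV_I)

lemma rotate: "\<mu> x y z = \<mu> y z x"
  using swap12 swap23 by metis

lemma left_commute: "\<mu> x y z = \<mu> z y x"
  using swap12 swap23 by metis

lemmas perm = swap12 swap23 left_commute

lemma idem [simp]: "\<mu> x x y = x" "\<mu> x y x = x" "\<mu> y x x = x"
  using median swap12 swap23 unfolding median_on_def by (metis UNIV_I)+

lemma distrib: "\<mu> a b (\<mu> x y z) = \<mu> (\<mu> a b x) (\<mu> a b y) z"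
  using median unfolding median_on_def by blast

lemma proj_idem [simp]: "\<mu> a b (\<mu> a b x) = \<mu> a b x"
  by (simp add: distrib)

text \<open>The axiom \<open>distrib\<close> projects only two of the three entries. As projections
  are idempotent, these two may be projected beforehand, and a second use of \<open>distrib\<close>
  after a rotation reaches the third.\<close>

lemma proj_median: "\<mu> a b (\<mu> x y z) = \<mu> (\<mu> a b x) (\<mu> a b y) (\<mu> a b z)"
proof -
  have "\<mu> a b (\<mu> x y z) = \<mu> a b (\<mu> (\<mu> a b x) (\<mu> a b y) z)"
    by (metis distrib proj_idem)
  also have "\<dots> = \<mu> a b (\<mu> z (\<mu> a b x) (\<mu> a b y))"
    by (metis rotate)
  also have "\<dots> = \<mu> (\<mu> a b z) (\<mu> a b x) (\<mu> a b y)"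
    by (simp add: distrib)
  finally show ?thesis by (metis rotate)
qed

abbreviation interval :: "'a \<Rightarrow> 'a \<Rightarrow> 'a set" where
  "interval \<equiv> median_interval UNIV \<mu>"

lemma interval_iff: "x \<in> interval a b \<longleftrightarrow> \<mu> a b x = x"
  by (simp add: median_interval_def)

lemma proj_in_interval: "\<mu> a b x \<in> interval a b"
  by (simp add: interval_iff)

lemma median_in_interval:
  assumes "x \<in> interval a b" "y \<in> interval a b"
  shows "\<mu> x y z \<in> interval a b"
  using assms by (simp add: interval_iff distrib)

lemma convex_interval: "median_convex UNIV \<mu> (interval a b)"
  unfolding median_convex_def
proof (intro conjI ballI subsetI)
  fix x y z
  assume "x \<in> interval a b" "y \<in> interval a b" "z \<in> interval x y"
  then show "z \<in> interval a b"
    using median_in_interval[of x a b y z] by (simp add: interval_iff)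
qed simp

lemma proj_nested: "u \<in> interval a b \<Longrightarrow> \<mu> a u (\<mu> a b z) = \<mu> a u z"
  by (simp add: interval_iff distrib swap23[of a u b])

lemma proj_nested': "u \<in> interval a b \<Longrightarrow> \<mu> a b (\<mu> a u z) = \<mu> a u z"
  by (simp add: interval_iff distrib)

lemma interval_mono: "u \<in> interval a b \<Longrightarrow> interval a u \<subseteq> interval a b"
  by (auto simp: interval_iff) (metis proj_nested' interval_iff)

section \<open>The order with a base point\<close>

text \<open>The meet-semilattice order with least element \<open>a\<close>:
  \<open>\<mu> a x y\<close> is the meet of \<open>x\<close> and \<open>y\<close>, and
  \<open>interval a y\<close> consists of the elements below \<open>y\<close>.\<close>

definition le :: "'a \<Rightarrow> 'a \<Rightarrow> 'a \<Rightarrow> bool" where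
  "le a x y \<longleftrightarrow> \<mu> a x y = x"

lemma le_refl [simp]: "le a x x" and le_base [simp]: "le a a x"
  by (simp_all add: le_def)

lemma le_interval: "le a x y \<longleftrightarrow> x \<in> interval a y"
  unfolding le_def interval_iff by (metis swap23)

lemma le_trans: "le a x y \<Longrightarrow> le a y z \<Longrightarrow> le a x z"
  using interval_mono[of y a z] by (auto simp: le_interval)

lemma le_antisym: "le a x y \<Longrightarrow> le a y x \<Longrightarrow> x = y"
  unfolding le_def by (metis swap23)

text \<open>Evaluate \<open>\<mu> z y (\<mu> a z x)\<close> in two ways: the inner meet is
  \<open>x\<close>, whereas \<open>distrib\<close> turns the whole into \<open>\<mu> z z x\<close>.
  This later makes a monotone parametrization of a chain a median map.\<close>

lemma le_between: "le a x z \<Longrightarrow> le a z y \<Longrightarrow> \<mu> x z y = z"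
proof -
  assume xz: "le a x z" and zy: "le a z y"
  have "\<mu> z y a = z" using zy unfolding le_def by (metis rotate)
  moreover have "\<mu> z y (\<mu> a z x) = \<mu> (\<mu> z y a) (\<mu> z y z) x"
    by (rule distrib)
  moreover have "\<mu> a z x = x" using xz unfolding le_def by (metis swap23)
  ultimately have "\<mu> z y x = z" by simp
  then show ?thesis by (metis rotate)
qed

lemma between_le:
  assumes "le a x y" "z \<in> interval x y"
  shows "le a x z" "le a z y"
proof -
  have "\<mu> a x z = \<mu> a x (\<mu> x y z)" using assms(2) by (simp add: interval_iff)
  also have "\<dots> = x" using assms(1) by (simp add: distrib le_def)
  finally show "le a x z" by (simp add: le_def)
  have "\<mu> a y z = \<mu> a y (\<mu> x y z)" using assms(2) by (simp add: interval_iff)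
  also have "\<dots> = \<mu> x y z" using assms(1) by (simp add: distrib le_def) (metis le_def swap23)
  also have "\<dots> = z" using assms(2) by (simp add: interval_iff)
  finally show "le a z y" unfolding le_def by (metis swap23)
qed

section \<open>Squares as products of two intervals\<close>

text \<open>In the lattice \<open>interval a c\<close> the meet is \<open>\<mu> a\<close> and the
  join is \<open>\<mu> c\<close>, so the two equations make \<open>u\<close> and \<open>v\<close>
  complements. The corners may coincide.\<close>

definition square :: "'a \<Rightarrow> 'a \<Rightarrow> 'a \<Rightarrow> 'a \<Rightarrow> bool" where
  "square a u v c \<longleftrightarrow> u \<in> interval a c \<and> v \<in> interval a c \<and> \<mu> a u v = a \<and> \<mu> c u v = c"

lemma square_sym: "square a u v c \<Longrightarrow> square a v u c"
  unfolding square_def by (metis swap23)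

text \<open>Distributivity: \<open>c\<close> is the join of \<open>u\<close> and \<open>v\<close>,
  so meeting it with \<open>z\<close> gives the join of the two smaller meets. The projection to
  \<open>interval a c\<close> is thus determined by two coordinates.\<close>

lemma square_decomp:
  assumes "square a u v c"
  shows "\<mu> a c z = \<mu> c (\<mu> a u z) (\<mu> a v z)"
proof -
  have "\<mu> a z c = \<mu> a z (\<mu> u v c)"
    using assms unfolding square_def by (metis rotate)
  also have "\<dots> = \<mu> (\<mu> a z u) (\<mu> a z v) c"
    by (rule distrib)
  finally show ?thesis by (metis rotate swap23)
qed

text \<open>The median map \<open>\<mu> a u\<close> sends \<open>c\<close> to \<open>u\<close>,
  fixes \<open>x\<close>, and collapses \<open>interval a v\<close> to \<open>a\<close> because
  \<open>u\<close> and \<open>v\<close> meet in \<open>a\<close>.\<close>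

lemma square_join_proj:
  assumes "square a u v c" "x \<in> interval a u" "y \<in> interval a v"
  shows "\<mu> a u (\<mu> c x y) = x"
proof -
  have u: "\<mu> a u c = u" using assms(1) unfolding square_def interval_iff by (metis swap23)
  have "\<mu> a u y = \<mu> a u (\<mu> a v y)" using assms(3) by (simp add: interval_iff)
  also have "\<dots> = a" using assms(1) by (simp add: distrib square_def)
  finally have "\<mu> a u y = a" .
  then have "\<mu> a u (\<mu> c x y) = \<mu> u x a"
    using assms(2) by (simp add: proj_median u interval_iff)
  also have "\<dots> = x" using assms(2) unfolding interval_iff by (metis rotate swap23)
  finally show ?thesis .
qed

lemma square_join_in:
  assumes "square a u v c" "x \<in> interval a u" "y \<in> interval a v"
  shows "\<mu> c x y \<in> interval a c"
proof (rule median_in_interval)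
  show "c \<in> interval a c" by (simp add: interval_iff)
  show "x \<in> interval a c" using assms interval_mono square_def by blast
qed

section \<open>Frames and coordinates by iterated joins\<close>

text \<open>The median with the top element of an interval is its lattice join, so along a frame
  this is the join of the \<open>x i\<close> with \<open>i < n\<close>, formed one stage at a
  time.\<close>

primrec join :: "'a \<Rightarrow> (nat \<Rightarrow> 'a) \<Rightarrow> (nat \<Rightarrow> 'a) \<Rightarrow> nat \<Rightarrow> 'a" where
  "join a b x 0 = a"
| "join a b x (Suc n) = \<mu> (b (Suc n)) (join a b x n) (x n)"

text \<open>Here \<open>b i\<close> is the join of the \<open>e j\<close> with \<open>j < i\<close>.
  Requiring a square at each stage allows the product decomposition to be proved by induction from
  the case of two factors.\<close>

definition frame :: "'a \<Rightarrow> (nat \<Rightarrow> 'a) \<Rightarrow> (nat \<Rightarrow> 'a) \<Rightarrow> nat \<Rightarrow> bool" where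
  "frame a e b n \<longleftrightarrow> b 0 = a \<and> (\<forall>i<n. square a (b i) (e i) (b (Suc i)))"

lemma frame_Suc: "frame a e b (Suc n) \<longleftrightarrow> frame a e b n \<and> square a (b n) (e n) (b (Suc n))"
  by (auto simp: frame_def less_Suc_eq)

lemma frame_le: "frame a e b n \<Longrightarrow> i < n \<Longrightarrow> e i \<in> interval a (b n)"
proof (induction n)
  case (Suc n)
  then show ?case
    using interval_mono[of "b n" a "b (Suc n)"] by (auto simp: frame_Suc square_def less_Suc_eq)
qed simp

text \<open>By \<open>square_decomp\<close>, each stage expresses the projection to the larger
  interval through those to \<open>b n\<close> and \<open>e n\<close>.\<close>

lemma frame_ext:
  "frame a e b n \<Longrightarrow> (\<And>i. i < n \<Longrightarrow> \<mu> a (e i) z = \<mu> a (e i) w) \<Longrightarrow> \<mu> a (b n) z = \<mu> a (b n) w"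
proof (induction n)
  case 0
  then show ?case by (simp add: frame_def)
next
  case (Suc n)
  then show ?case
    by (simp add: frame_Suc square_decomp[of a "b n" "e n" "b (Suc n)"])
qed

lemma join_in:
  "frame a e b n \<Longrightarrow> (\<And>i. i < n \<Longrightarrow> x i \<in> interval a (e i)) \<Longrightarrow> join a b x n \<in> interval a (b n)"
  by (induction n) (auto simp: frame_Suc interval_iff intro: square_join_in[unfolded interval_iff])

text \<open>The last coordinate comes from the last square with its sides exchanged. For an earlier
  one, projecting first onto \<open>interval a (b n)\<close> strips off \<open>x n\<close> and
  leaves the shorter join.\<close>

lemma proj_join:
  "frame a e b n \<Longrightarrow> (\<And>i. i < n \<Longrightarrow> x i \<in> interval a (e i)) \<Longrightarrow> i < n
    \<Longrightarrow> \<mu> a (e i) (join a b x n) = x i"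
proof (induction n)
  case (Suc n)
  have sq: "square a (b n) (e n) (b (Suc n))" and fr: "frame a e b n"
    using Suc.prems by (auto simp: frame_Suc)
  have J: "join a b x n \<in> interval a (b n)" and x: "x n \<in> interval a (e n)"
    using join_in[OF fr] Suc.prems by auto
  show ?case
  proof (cases "i = n")
    case True
    then show ?thesis
      using square_join_proj[OF square_sym[OF sq] x J] by simp (metis swap23)
  next
    case False
    with Suc.prems have i: "i < n" by simp
    have "\<mu> a (e i) (join a b x (Suc n)) = \<mu> a (e i) (\<mu> a (b n) (join a b x (Suc n)))"
      using proj_nested[OF frame_le[OF fr i]] by simp
    also have "\<dots> = \<mu> a (e i) (join a b x n)"
      using square_join_proj[OF sq J x] by simp
    also have "\<dots> = x i"
      using Suc.IH[OF fr] Suc.prems i by auto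
    finally show ?thesis .
  qed
qed simp

text \<open>By \<open>frame_ext\<close> coordinates determine an element of
  \<open>interval a (b n)\<close>. Identities between joins are checked coordinatewise through
  this.\<close>

lemma join_unique:
  assumes "frame a e b n" "\<And>i. i < n \<Longrightarrow> x i \<in> interval a (e i)"
    and "z \<in> interval a (b n)" "\<And>i. i < n \<Longrightarrow> \<mu> a (e i) z = x i"
  shows "join a b x n = z"
proof -
  have "\<mu> a (b n) (join a b x n) = \<mu> a (b n) z"
    using assms proj_join[OF assms(1)] by (intro frame_ext[OF assms(1)]) simp
  then show ?thesis
    using assms(3) join_in[OF assms(1,2)] by (simp add: interval_iff)
qed

lemma join_median:
  assumes "frame a e b n" "\<And>i. i < n \<Longrightarrow> x i \<in> interval a (e i)"
    "\<And>i. i < n \<Longrightarrow> y i \<in> interval a (e i)" "\<And>i. i < n \<Longrightarrow> z i \<in> interval a (e i)"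
  shows "join a b (\<lambda>i. \<mu> (x i) (y i) (z i)) n = \<mu> (join a b x n) (join a b y n) (join a b z n)"
  using assms
  by (intro join_unique[OF assms(1)] median_in_interval join_in[OF assms(1)])
    (simp_all add: proj_median proj_join[OF assms(1)])

lemma join_inj:
  assumes "frame a e b n" "\<And>i. i < n \<Longrightarrow> x i \<in> interval a (e i)"
    "\<And>i. i < n \<Longrightarrow> y i \<in> interval a (e i)" "join a b x n = join a b y n" "i < n"
  shows "x i = y i"
  using assms proj_join by metis

section \<open>Embedded cubes, the rank and chains\<close>

lemma frame_of_cube:
  assumes "median_embedding (discrete_cube r) (cube_median r) UNIV \<mu> f"
  obtains a e b where "frame a e b r" "\<And>i. i < r \<Longrightarrow> e i \<noteq> a"
proof -
  \<comment> \<open>Vertices of the cube are encoded as subsets of the index set, which turns the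
    median into the majority operation. The frame has the empty set as base, singletons as edges and
    the initial segments \<open>{..<i}\<close> as partial joins.\<close>
  define ind :: "nat set \<Rightarrow> nat \<Rightarrow> real" where "ind A = (\<lambda>i\<in>{..<r}. if i \<in> A then 1 else 0)" for A
  have ind: "ind A \<in> discrete_cube r" for A
    by (auto simp: ind_def discrete_cube_def)
  have f: "f (cube_median r (ind A) (ind B) (ind C)) = \<mu> (f (ind A)) (f (ind B)) (f (ind C))" for A B C
    using assms ind by (auto simp: median_embedding_def median_map_def)
  have med: "\<mu> (f (ind A)) (f (ind B)) (f (ind C)) = f (ind (A \<inter> B \<union> (A \<union> B) \<inter> C))" for A B C
  proof -
    have "cube_median r (ind A) (ind B) (ind C) = ind (A \<inter> B \<union> (A \<union> B) \<inter> C)"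
      by (auto simp: cube_median_def ind_def middle_def)
    then show ?thesis using f[of A B C] by simp
  qed
  have "square (f (ind {})) (f (ind {..<i})) (f (ind {i})) (f (ind {..<Suc i}))" for i
    by (auto simp: square_def interval_iff med intro!: arg_cong[where f = "\<lambda>A. f (ind A)"])
  then have "frame (f (ind {})) (\<lambda>i. f (ind {i})) (\<lambda>i. f (ind {..<i})) r"
    by (simp add: frame_def)
  moreover have "f (ind {i}) \<noteq> f (ind {})" if "i < r" for i
  proof
    assume "f (ind {i}) = f (ind {})"
    then have "ind {i} = ind {}"
      using assms ind unfolding median_embedding_def by (meson inj_onD)
    then have "ind {i} i = ind {} i" by simp
    with that show False by (simp add: ind_def)
  qed
  ultimately show ?thesis using that by blast
qed

text \<open>\<open>\<mu> x y\<close> and \<open>\<mu> a c\<close> both fix \<open>x\<close> and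
  \<open>y\<close>, so by \<open>distrib\<close> these two lie between their meet and their
  join.\<close>

lemma square_of_pair:
  assumes "x \<in> interval a c" "y \<in> interval a c"
  shows "square (\<mu> a x y) x y (\<mu> c x y)"
proof -
  have *: "\<mu> (\<mu> a x y) (\<mu> c x y) w = w" if "w = x \<or> w = y" for w
  proof -
    have "\<mu> x y w = w" "\<mu> a c w = w" using that assms by (auto simp: interval_iff)
    then have "\<mu> (\<mu> x y a) (\<mu> x y c) w = w"
      by (metis distrib)
    then show ?thesis by (metis rotate)
  qed
  have "\<mu> (\<mu> t x y) x y = \<mu> t x y" for t
    by (metis proj_idem rotate)
  with * show ?thesis by (simp add: square_def interval_iff)
qed

text \<open>The map from {0, 1} to the ends of an edge. Every nonzero value goes to
  \<open>c\<close>, so that \<open>corner_in\<close> holds for all \<open>t\<close>.\<close>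

definition corner :: "'a \<Rightarrow> 'a \<Rightarrow> real \<Rightarrow> 'a" where
  "corner a c t = (if t = 0 then a else c)"

lemma corner_in: "corner a c t \<in> interval a c"
  by (simp add: corner_def interval_iff)

lemma corner_middle:
  assumes "s \<in> {0,1}" "t \<in> {0,1}" "u \<in> {0,1}"
  shows "corner a c (middle s t u) = \<mu> (corner a c s) (corner a c t) (corner a c u)"
  using assms by (auto simp: corner_def middle_def)

text \<open>Otherwise splitting the edge \<open>e i\<close> along an incomparable pair yields an \<open>(r + 1)\<close>-cube.\<close>

lemma edge_chain:
  assumes fr: "frame a e b r" and ne: "\<And>i. i < r \<Longrightarrow> e i \<noteq> a"
    and rank: "\<And>n f. median_embedding (discrete_cube n) (cube_median n) UNIV \<mu> f \<Longrightarrow> n \<le> r"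
    and i: "i < r" and x: "x \<in> interval a (e i)" and y: "y \<in> interval a (e i)"
  shows "le a x y \<or> le a y x"
proof (rule ccontr)
  assume incomparable: "\<not> (le a x y \<or> le a y x)"
  \<comment> \<open>Meet and join of the incomparable pair; incomparability keeps \<open>m\<close>
    distinct from both \<open>x\<close> and \<open>y\<close>.\<close>
  define m M where "m = \<mu> a x y" and "M = \<mu> (e i) x y"
  have mx: "m \<noteq> x" "m \<noteq> y"
    using incomparable swap23 unfolding m_def le_def by metis+
  have sq: "square m x y M"
    unfolding m_def M_def by (rule square_of_pair[OF x y])
  \<comment> \<open>The square is viewed as a frame of length two based at \<open>m\<close>, with a
    degenerate first stage \<open>square m m x x\<close>, so that the lemmas on frames apply to
    it.\<close>
  define pq where "pq n = (if n = (0::nat) then x else y)" for n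
  define B where "B n = (if n = 0 then m else if n = 1 then x else M)" for n :: nat
  have fr2: "frame m pq B 2"
    using sq by (auto simp: frame_def B_def pq_def less_2_cases_iff square_def interval_iff)
  \<comment> \<open>As \<open>s\<close> and \<open>t\<close> range over 0 and 1, this runs through
    the four corners \<open>m\<close>, \<open>x\<close>, \<open>y\<close>, \<open>M\<close>.\<close>
  define split where
    "split s t = join m B (\<lambda>n. corner m (pq n) (if n = 0 then s else t)) 2" for s t
  have m_in: "m \<in> interval a (e i)"
    unfolding m_def by (metis median_in_interval rotate x y)
  have M_in: "M \<in> interval a (e i)"
    unfolding M_def by (metis median_in_interval rotate x y)
  have split_in: "split s t \<in> interval a (e i)" for s t
  proof -
    have "split s t \<in> interval m (B 2)"
      unfolding split_def by (rule join_in[OF fr2]) (rule corner_in)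
    then show ?thesis
      using m_in M_in median_in_interval by (simp add: B_def) (metis interval_iff)
  qed
  have split_middle: "split (middle s s' s'') (middle t t' t'') = \<mu> (split s t) (split s' t') (split s'' t'')"
    if "{s,s',s'',t,t',t''} \<subseteq> {0,1}" for s s' s'' t t' t''
  proof -
    have "(\<lambda>n. corner m (pq n) (if n = 0 then middle s s' s'' else middle t t' t''))
        = (\<lambda>n. \<mu> (corner m (pq n) (if n = 0 then s else t)) (corner m (pq n) (if n = 0 then s' else t'))
            (corner m (pq n) (if n = 0 then s'' else t'')))"
      using that by (intro ext) (simp add: corner_middle)
    then show ?thesis
      unfolding split_def by (simp only: join_median[OF fr2 corner_in corner_in corner_in])
  qed
  have split_inj: "s = s' \<and> t = t'"
    if "split s t = split s' t'" "{s,s',t,t'} \<subseteq> {0,1}" for s s' t t'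
  proof -
    have "corner m (pq n) (if n = 0 then s else t) = corner m (pq n) (if n = 0 then s' else t')"
      if "n < 2" for n
      using \<open>split s t = split s' t'\<close> unfolding split_def
      by (rule join_inj[OF fr2 corner_in corner_in _ that])
    from this[of 0] this[of 1] mx that(2) show ?thesis
      by (auto simp: corner_def pq_def split: if_splits)
  qed
  \<comment> \<open>Coordinate \<open>i\<close> and the additional coordinate \<open>r\<close>
    together select a corner of the square inside the edge \<open>e i\<close>; every other
    coordinate selects an end of its own edge.\<close>
  define c where "c \<epsilon> j = (if j = i then split (\<epsilon> i) (\<epsilon> r) else corner a (e j) (\<epsilon> j))" for \<epsilon> j
  have c_in: "c \<epsilon> j \<in> interval a (e j)" for \<epsilon> j
    by (simp add: c_def split_in corner_in)
  have cube: "\<epsilon> j \<in> {0,1}" if "\<epsilon> \<in> discrete_cube (Suc r)" "j \<le> r" for \<epsilon> j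
    using that unfolding discrete_cube_def by (meson PiE_mem le_imp_less_Suc lessThan_iff)
  have "median_embedding (discrete_cube (Suc r)) (cube_median (Suc r)) UNIV \<mu> (\<lambda>\<epsilon>. join a b (c \<epsilon>) r)"
    unfolding median_embedding_def median_map_def
  proof (intro conjI ballI inj_onI)
    fix \<epsilon> \<eta> \<theta>
    assume in_cube: "\<epsilon> \<in> discrete_cube (Suc r)" "\<eta> \<in> discrete_cube (Suc r)" "\<theta> \<in> discrete_cube (Suc r)"
    have "c (cube_median (Suc r) \<epsilon> \<eta> \<theta>) j = \<mu> (c \<epsilon> j) (c \<eta> j) (c \<theta> j)" if "j < r" for j
      using that i cube[OF in_cube(1)] cube[OF in_cube(2)] cube[OF in_cube(3)]
      by (auto simp: c_def cube_median_def split_middle corner_middle)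
    then have "join a b (c (cube_median (Suc r) \<epsilon> \<eta> \<theta>)) r = join a b (\<lambda>j. \<mu> (c \<epsilon> j) (c \<eta> j) (c \<theta> j)) r"
      by (intro join_unique[OF fr c_in join_in[OF fr]] ) (simp_all add: proj_join[OF fr] c_in median_in_interval)
    then show "join a b (c (cube_median (Suc r) \<epsilon> \<eta> \<theta>)) r
        = \<mu> (join a b (c \<epsilon>) r) (join a b (c \<eta>) r) (join a b (c \<theta>) r)"
      by (simp add: join_median[OF fr c_in c_in c_in])
  next
    fix \<epsilon> \<eta>
    assume in_cube: "\<epsilon> \<in> discrete_cube (Suc r)" "\<eta> \<in> discrete_cube (Suc r)"
      and eq: "join a b (c \<epsilon>) r = join a b (c \<eta>) r"
    have c: "c \<epsilon> j = c \<eta> j" if "j < r" for j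
      by (rule join_inj[OF fr c_in c_in eq that])
    have "\<epsilon> i = \<eta> i \<and> \<epsilon> r = \<eta> r"
      using c[OF i] i cube[OF in_cube(1)] cube[OF in_cube(2)] by (intro split_inj) (auto simp: c_def)
    moreover have "\<epsilon> j = \<eta> j" if "j < r" "j \<noteq> i" for j
      using c[OF that(1)] ne[OF that(1)] that cube[OF in_cube(1), of j] cube[OF in_cube(2), of j]
      by (auto simp: c_def corner_def split: if_splits)
    ultimately have "\<epsilon> j = \<eta> j" if "j \<in> {..<Suc r}" for j
      using that by (cases "j = i"; cases "j = r") auto
    then show "\<epsilon> = \<eta>"
      using in_cube unfolding discrete_cube_def by (metis PiE_ext)
  qed simp
  from rank[OF this] show False by simp
qed

end

section \<open>Lipschitz medians on geodesic spaces\<close>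

locale lipschitz_median = median_algebra \<mu> for \<mu> :: "'a::metric_space \<Rightarrow> 'a \<Rightarrow> 'a \<Rightarrow> 'a" +
  fixes k :: real
  assumes geodesic: "geodesic_set (UNIV :: 'a set)"
    and k_ge_1: "1 \<le> k"
    and Lipschitz: "dist (\<mu> a b c) (\<mu> a' b' c') \<le> k * (dist a a' + dist b b' + dist c c')"
begin

lemma proj_Lipschitz: "dist (\<mu> a b x) (\<mu> a b y) \<le> k * dist x y"
  using Lipschitz[of a b x a b y] by simp

text \<open>One more median adds a coordinate and multiplies by \<open>k\<close>, so a constant
  \<open>C\<close> for \<open>n\<close> becomes \<open>k * (C + 1)\<close>.\<close>

lemma join_Lipschitz:
  "\<exists>C\<ge>0. \<forall>x y. dist (join a b x n) (join a b y n) \<le> C * (\<Sum>i<n. dist (x i) (y i))"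
proof (induction n)
  case (Suc n)
  then obtain C where C: "C \<ge> 0" "\<And>x y. dist (join a b x n) (join a b y n) \<le> C * (\<Sum>i<n. dist (x i) (y i))"
    by blast
  have "dist (join a b x (Suc n)) (join a b y (Suc n)) \<le> (k * (C + 1)) * (\<Sum>i<Suc n. dist (x i) (y i))" for x y
  proof -
    have s: "0 \<le> (\<Sum>i<n. dist (x i) (y i))" by (simp add: sum_nonneg)
    have "dist (join a b x (Suc n)) (join a b y (Suc n))
        \<le> k * (dist (join a b x n) (join a b y n) + dist (x n) (y n))"
      using Lipschitz[of "b (Suc n)" "join a b x n" "x n" "b (Suc n)" "join a b y n" "y n"] by simp
    also have "\<dots> \<le> k * (C * (\<Sum>i<n. dist (x i) (y i)) + dist (x n) (y n))"
      using k_ge_1 C(2)[of x y] by (intro mult_left_mono) auto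
    also have "\<dots> \<le> k * ((C + 1) * (\<Sum>i<Suc n. dist (x i) (y i)))"
      using k_ge_1 C(1) s by (intro mult_left_mono) (auto simp: algebra_simps)
    finally show ?thesis by (simp add: mult.assoc)
  qed
  moreover have "0 \<le> k * (C + 1)" using k_ge_1 C(1) by simp
  ultimately show ?case by blast
qed auto

text \<open>The projection \<open>\<mu> x y\<close> pushes a geodesic into the interval, fixes its
  ends and stretches distances by at most \<open>k\<close>.\<close>

lemma interval_path:
  obtains q where "q 0 = x" "q (dist x y) = y" "q ` {0..dist x y} \<subseteq> interval x y"
    "\<And>s t. s \<in> {0..dist x y} \<Longrightarrow> t \<in> {0..dist x y} \<Longrightarrow> dist (q s) (q t) \<le> k * \<bar>s - t\<bar>"
proof -
  obtain g where g: "g 0 = x" "g (dist x y) = y"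
    "\<And>s t. s \<in> {0..dist x y} \<Longrightarrow> t \<in> {0..dist x y} \<Longrightarrow> dist (g s) (g t) = \<bar>s - t\<bar>"
    using geodesic unfolding geodesic_set_def by (metis UNIV_I)
  show ?thesis
  proof (rule that[of "\<lambda>t. \<mu> x y (g t)"])
    show "dist (\<mu> x y (g s)) (\<mu> x y (g t)) \<le> k * \<bar>s - t\<bar>"
      if "s \<in> {0..dist x y}" "t \<in> {0..dist x y}" for s t
      using proj_Lipschitz[of x y "g s" "g t"] g(3)[OF that] by simp
  qed (auto simp: g proj_in_interval)
qed

lemma Lipschitz_path_continuous:
  fixes q :: "real \<Rightarrow> 'a"
  assumes "\<And>s t. s \<in> A \<Longrightarrow> t \<in> A \<Longrightarrow> dist (q s) (q t) \<le> k * \<bar>s - t\<bar>"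
  shows "continuous_on A q"
proof -
  have "k-lipschitz_on A q"
    using assms k_ge_1 by (intro lipschitz_onI) (auto simp: dist_real_def)
  then show ?thesis by (rule lipschitz_on_continuous_on)
qed

lemma proj_continuous: "continuous_on A (\<mu> a b)"
proof -
  have "k-lipschitz_on A (\<mu> a b)"
    using proj_Lipschitz k_ge_1 by (intro lipschitz_onI) auto
  then show ?thesis by (rule lipschitz_on_continuous_on)
qed

section \<open>Arc length on chains\<close>

definition chain :: "'a \<Rightarrow> 'a \<Rightarrow> bool" where
  "chain a e \<longleftrightarrow> (\<forall>x\<in>interval a e. \<forall>y\<in>interval a e. le a x y \<or> le a y x)"

lemma chainD: "chain a e \<Longrightarrow> le a x e \<Longrightarrow> le a y e \<Longrightarrow> le a x y \<or> le a y x"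
  by (simp add: chain_def le_interval)

text \<open>Take \<open>T z\<close> to be the last time at which a path from
  \<open>interval_path\<close> is below \<open>z\<close>. It is monotone in \<open>z\<close>, and
  the path is at \<open>z\<close> at that time. So the segment from \<open>x\<close> to
  \<open>y\<close> has length at most \<open>k * dist x y\<close>, even if the path moves back and
  forth.\<close>

lemma last_hit:
  assumes chain: "chain a e" and xy: "le a x y" and ye: "le a y e"
  obtains T where "T x \<ge> 0" "T y \<le> dist x y"
    "\<And>z w. le a x z \<Longrightarrow> le a z w \<Longrightarrow> le a w y \<Longrightarrow> dist z w \<le> k * (T w - T z)"
proof -
  define L where "L = dist x y"
  have L: "0 \<le> L" by (simp add: L_def)
  obtain q where q: "q 0 = x" "q L = y" "q ` {0..L} \<subseteq> interval x y"
    "\<And>s t. s \<in> {0..L} \<Longrightarrow> t \<in> {0..L} \<Longrightarrow> dist (q s) (q t) \<le> k * \<bar>s - t\<bar>"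
    using interval_path[of x y] unfolding L_def by metis
  have cont: "continuous_on {0..L} q"
    by (rule Lipschitz_path_continuous) (rule q(4))
  have qy: "le a (q t) y" if "t \<in> {0..L}" for t
    using q(3) that between_le(2)[OF xy] by blast
  define S where "S z = {t \<in> {0..L}. le a (q t) z}" for z
  define T where "T z = Sup (S z)" for z
  have bdd: "bdd_above (S z)" for z
    by (rule bdd_above_mono[of "{0..L}"]) (auto simp: S_def)
  \<comment> \<open>With \<open>h\<close> the identity this is the set of times below
    \<open>z\<close>; with \<open>h\<close> constantly \<open>z\<close> it is the set of times above
    \<open>z\<close>.\<close>
  have closed: "closed {t \<in> {0..L}. \<mu> a z (q t) = h (q t)}" if "continuous_on (q ` {0..L}) h" for z h
  proof -
    have "continuous_on {0..L} (\<lambda>t. dist (\<mu> a z (q t)) (h (q t)))"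
      using continuous_on_compose2[OF proj_continuous[of UNIV] cont]
        continuous_on_compose2[OF that cont] by (intro continuous_on_dist) auto
    from continuous_closed_preimage_constant[OF this, of 0] show ?thesis
      by simp
  qed
  have S_closed: "closed (S z)" for z
  proof -
    have "S z = {t \<in> {0..L}. \<mu> a z (q t) = q t}"
      unfolding S_def le_def by (metis swap23)
    then show ?thesis using closed[of "\<lambda>x. x" z] by simp
  qed
  have T_in: "T z \<in> S z" if "le a x z" for z
  proof -
    have "0 \<in> S z" using that L by (simp add: S_def q)
    then show ?thesis
      unfolding T_def using bdd S_closed by (intro closed_contains_Sup) auto
  qed
  have T_mono: "T z \<le> T w" if "le a x z" "le a z w" for z w
    unfolding T_def using T_in[OF that(1)] le_trans[OF _ that(2)] bdd
    by (intro cSup_subset_mono) (auto simp: S_def)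
  have hit: "q (T z) = z" if "le a x z" "le a z y" for z
  proof (cases "T z = L")
    case True
    then have "le a y z" using T_in[OF that(1)] by (simp add: S_def q)
    then show ?thesis using True le_antisym that(2) q by metis
  next
    case False
    have T: "T z \<in> {0..L}" "le a (q (T z)) z" using T_in[OF that(1)] by (auto simp: S_def)
    with False have TL: "T z < L" by simp
    \<comment> \<open>After \<open>T z\<close> the path is never below \<open>z\<close>, hence above
      it as the order is total. Being above is a closed condition, so it also holds at
      \<open>T z\<close> itself.\<close>
    define G where "G = {t \<in> {0..L}. \<mu> a z (q t) = z}"
    have "t \<in> G" if t: "t \<in> {T z<..<L}" for t
    proof -
      have t0: "t \<in> {0..L}" using t T by auto
      then have "t \<notin> S z"
        using cSup_upper[OF _ bdd, of t z] t unfolding T_def by auto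
      then have "\<not> le a (q t) z" using t0 by (simp add: S_def)
      then have "le a z (q t)"
        using chainD[OF chain] le_trans[OF qy[OF t0] ye] le_trans[OF \<open>le a z y\<close> ye] by blast
      then show ?thesis using t0 by (simp add: G_def le_def)
    qed
    then have "closure {T z<..<L} \<subseteq> G"
      using closed[of "\<lambda>_. z" z] by (intro closure_minimal) (auto simp: G_def)
    then have "T z \<in> G" using TL by auto
    then have "le a z (q (T z))" by (simp add: G_def le_def)
    with T(2) show ?thesis by (rule le_antisym)
  qed
  show ?thesis
  proof (rule that[of T])
    show "T x \<ge> 0" "T y \<le> dist x y"
      using T_in[of x] T_in[OF xy] by (auto simp: S_def L_def)
    fix z w assume *: "le a x z" "le a z w" "le a w y"
    have "dist (q (T z)) (q (T w)) \<le> k * \<bar>T z - T w\<bar>"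
      using T_in[of z] T_in[of w] * le_trans[of a x z w] by (intro q(4)) (auto simp: S_def)
    then show "dist z w \<le> k * (T w - T z)"
      using T_mono[of z w] * hit[of z] hit[of w] le_trans[of a x z w] le_trans[of a z w y] by simp
  qed
qed

text \<open>\<open>arclen a y\<close> is the arc length from \<open>a\<close> to \<open>y\<close>, defined by minimising over its upper bounds
  instead of taking a supremum over partitions.\<close>

definition lengths :: "'a \<Rightarrow> 'a \<Rightarrow> ('a \<Rightarrow> real) set" where
  "lengths a y = {h. h a = 0 \<and> (\<forall>z w. le a z w \<longrightarrow> le a w y \<longrightarrow> dist z w \<le> h w - h z)}"

definition arclen :: "'a \<Rightarrow> 'a \<Rightarrow> real" where
  "arclen a y = (INF h\<in>lengths a y. h y)"

lemma lengths_mono: "le a x y \<Longrightarrow> lengths a y \<subseteq> lengths a x"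
  unfolding lengths_def using le_trans by blast

text \<open>Arc length is finite: last hitting times from \<open>a\<close> to \<open>y\<close>,
  scaled by \<open>k\<close> and shifted to vanish at \<open>a\<close>, form an upper bound.\<close>

lemma lengths_nonempty:
  assumes "chain a e" "le a y e"
  shows "lengths a y \<noteq> {}"
proof -
  obtain T where "\<And>z w. le a a z \<Longrightarrow> le a z w \<Longrightarrow> le a w y \<Longrightarrow> dist z w \<le> k * (T w - T z)"
    using last_hit[OF assms(1) le_base assms(2)] by metis
  then have "(\<lambda>z. k * (T z - T a)) \<in> lengths a y"
    by (simp add: lengths_def algebra_simps)
  then show ?thesis by blast
qed

lemma arclen_le: "h \<in> lengths a y \<Longrightarrow> arclen a y \<le> h y"
proof -
  assume h: "h \<in> lengths a y"
  have "0 \<le> g y" if "g \<in> lengths a y" for g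
    using that zero_le_dist[of a y] unfolding lengths_def
    by (smt (verit) le_base le_refl mem_Collect_eq)
  then have "bdd_below ((\<lambda>h. h y) ` lengths a y)"
    by (intro bdd_belowI[of _ 0]) auto
  then show ?thesis unfolding arclen_def using h by (rule cINF_lower)
qed

lemma arclen_base: assumes "chain a e" shows "arclen a a = 0"
proof -
  have "lengths a a \<noteq> {}"
    using lengths_nonempty[OF assms le_base] .
  then have "(\<lambda>h. h a) ` lengths a a = {0}"
    by (auto simp: lengths_def image_iff)
  then show ?thesis unfolding arclen_def by simp
qed

text \<open>A bound \<open>h\<close> for \<open>y\<close> is also one for \<open>x\<close>, and it
  grows by at least \<open>dist x y\<close> in between; take the infimum over
  \<open>h\<close>.\<close>

lemma arclen_lower:
  assumes "chain a e" "le a x y" "le a y e"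
  shows "dist x y \<le> arclen a y - arclen a x"
proof -
  have "arclen a x + dist x y \<le> h y" if "h \<in> lengths a y" for h
  proof -
    have "h \<in> lengths a x" using that lengths_mono[OF assms(2)] by blast
    moreover have "dist x y \<le> h y - h x" using that assms(2) by (simp add: lengths_def)
    ultimately show ?thesis using arclen_le[of h a x] by simp
  qed
  then have "arclen a x + dist x y \<le> arclen a y"
    unfolding arclen_def[of a y] by (rule cINF_greatest[OF lengths_nonempty[OF assms(1,3)]])
  then show ?thesis by simp
qed

text \<open>A bound \<open>h\<close> for \<open>x\<close> is extended beyond \<open>x\<close> by the
  scaled hitting times of \<open>last_hit\<close>. The resulting bound for \<open>y\<close> exceeds
  \<open>h x\<close> by at most \<open>k * dist x y\<close>.\<close>

lemma arclen_upper:
  assumes chain: "chain a e" and xy: "le a x y" and ye: "le a y e"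
  shows "arclen a y - arclen a x \<le> k * dist x y"
proof -
  obtain T where T: "T x \<ge> 0" "T y \<le> dist x y"
    "\<And>z w. le a x z \<Longrightarrow> le a z w \<Longrightarrow> le a w y \<Longrightarrow> dist z w \<le> k * (T w - T z)"
    using last_hit[OF assms] by metis
  have "arclen a y - k * dist x y \<le> h x" if h: "h \<in> lengths a x" for h
  proof -
    define g where "g z = (if le a z x then h z else h x + k * (T z - T x))" for z
    have h_le: "dist z w \<le> h w - h z" if "le a z w" "le a w x" for z w
      using h that by (simp add: lengths_def)
    have "dist z w \<le> g w - g z" if zw: "le a z w" and wy: "le a w y" for z w
    proof -
      have cmp: "le a v x \<or> le a x v" if "le a v y" for v
        using chainD[OF chain le_trans[OF that ye] le_trans[OF xy ye]] .
      \<comment> \<open>Both points below \<open>x\<close>, \<open>x\<close> between them, or both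
        above \<open>x\<close>; the middle case is the triangle inequality through
        \<open>x\<close>.\<close>
      consider "le a w x" | "\<not> le a w x" "le a z x" | "\<not> le a w x" "\<not> le a z x" by blast
      then show ?thesis
      proof cases
        case 1
        then show ?thesis using h_le[OF zw] le_trans[OF zw] by (simp add: g_def)
      next
        case 2
        then have "le a x w" using cmp[OF wy] by blast
        then show ?thesis
          using 2 h_le[OF 2(2) le_refl] T(3)[OF le_refl _ wy] dist_triangle[of z w x]
          by (simp add: g_def)
      next
        case 3
        then have "le a x z" using cmp[OF le_trans[OF zw wy]] by blast
        then show ?thesis
          using 3 T(3)[OF _ zw wy] by (simp add: g_def algebra_simps)
      qed
    qed
    moreover have "g a = 0" using h by (simp add: g_def lengths_def)
    ultimately have "arclen a y \<le> g y" by (intro arclen_le) (simp add: lengths_def)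
    also have "g y \<le> h x + k * dist x y"
    proof (cases "le a y x")
      case True
      then have "x = y" using xy le_antisym by blast
      then show ?thesis by (simp add: g_def)
    next
      case False
      have "k * (T y - T x) \<le> k * dist x y"
        using T(1,2) k_ge_1 by (intro mult_left_mono) auto
      then show ?thesis using False by (simp add: g_def)
    qed
    finally show ?thesis by simp
  qed
  then have "arclen a y - k * dist x y \<le> arclen a x"
    unfolding arclen_def[of a x]
    by (intro cINF_greatest lengths_nonempty[OF chain le_trans[OF xy ye]]) auto
  then show ?thesis by simp
qed

lemma arclen_bilipschitz:
  assumes chain: "chain a e" and x: "x \<in> interval a e" and y: "y \<in> interval a e"
  shows "dist x y \<le> \<bar>arclen a x - arclen a y\<bar>" "\<bar>arclen a x - arclen a y\<bar> \<le> k * dist x y"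
proof -
  have "dist x y \<le> \<bar>arclen a x - arclen a y\<bar> \<and> \<bar>arclen a x - arclen a y\<bar> \<le> k * dist x y"
    if "le a x y" "le a y e" for x y
    using arclen_lower[OF chain that] arclen_upper[OF chain that] zero_le_dist[of x y] by linarith
  moreover have "le a x e" "le a y e" using x y by (simp_all add: le_interval)
  ultimately show "dist x y \<le> \<bar>arclen a x - arclen a y\<bar>" "\<bar>arclen a x - arclen a y\<bar> \<le> k * dist x y"
    using chainD[OF chain, of x y] by (metis abs_minus_commute dist_commute)+
qed

text \<open>Surjectivity is the intermediate value theorem along a path from \<open>a\<close> to
  \<open>e\<close> inside the interval, where arc length is Lipschitz and so continuous.\<close>

lemma arclen_image:
  assumes chain: "chain a e"
  shows "arclen a ` interval a e = {0..arclen a e}"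
proof
  show "arclen a ` interval a e \<subseteq> {0..arclen a e}"
  proof clarify
    fix x assume "x \<in> interval a e"
    then have "le a x e" by (simp add: le_interval)
    then have "0 \<le> arclen a x" "arclen a x \<le> arclen a e"
      using arclen_lower[OF chain \<open>le a x e\<close> le_refl] arclen_lower[OF chain le_base, of x]
        arclen_base[OF chain] zero_le_dist[of a x] zero_le_dist[of x e] by linarith+
    then show "arclen a x \<in> {0..arclen a e}" by simp
  qed
  obtain q where q: "q 0 = a" "q (dist a e) = e" "q ` {0..dist a e} \<subseteq> interval a e"
    "\<And>s t. s \<in> {0..dist a e} \<Longrightarrow> t \<in> {0..dist a e} \<Longrightarrow> dist (q s) (q t) \<le> k * \<bar>s - t\<bar>"
    using interval_path[of a e] by metis
  have "k-lipschitz_on (interval a e) (arclen a)"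
    using arclen_bilipschitz(2)[OF chain] k_ge_1 by (intro lipschitz_onI) (auto simp: dist_real_def)
  then have "continuous_on (interval a e) (arclen a)" by (rule lipschitz_on_continuous_on)
  then have cont: "continuous_on {0..dist a e} (\<lambda>t. arclen a (q t))"
    using Lipschitz_path_continuous[OF q(4)] q(3) by (rule continuous_on_compose2)
  show "{0..arclen a e} \<subseteq> arclen a ` interval a e"
  proof
    fix s assume "s \<in> {0..arclen a e}"
    then obtain t where "0 \<le> t" "t \<le> dist a e" "arclen a (q t) = s"
      using IVT'[of "\<lambda>t. arclen a (q t)" 0 s "dist a e"] cont q(1,2) arclen_base[OF chain] by auto
    then show "s \<in> arclen a ` interval a e" using q(3) by force
  qed
qed

lemma le_arclen:
  assumes chain: "chain a e" and "x \<in> interval a e" "y \<in> interval a e" "arclen a x \<le> arclen a y"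
  shows "le a x y"
proof (rule ccontr)
  assume n: "\<not> le a x y"
  moreover have xy: "le a x e" "le a y e" using assms by (simp_all add: le_interval)
  ultimately have "le a y x" using chainD[OF chain, of x y] by blast
  then have "dist y x \<le> arclen a x - arclen a y" by (rule arclen_lower[OF chain _ xy(1)])
  then have "dist y x \<le> 0" using assms(4) by linarith
  with n show False by simp
qed

section \<open>Parametrizing chains and cubes\<close>

lemma arc_parametrization:
  assumes chain: "chain a e" and ne: "e \<noteq> a"
  obtains \<gamma> K where "K \<ge> 1" "\<gamma> ` {0..1} = interval a e"
    "\<And>s t u. s \<in> {0..1} \<Longrightarrow> t \<in> {0..1} \<Longrightarrow> u \<in> {0..1} \<Longrightarrow> \<gamma> (middle s t u) = \<mu> (\<gamma> s) (\<gamma> t) (\<gamma> u)"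
    "\<And>s t. s \<in> {0..1} \<Longrightarrow> t \<in> {0..1} \<Longrightarrow> \<bar>s - t\<bar> \<le> K * dist (\<gamma> s) (\<gamma> t)"
    "\<And>s t. s \<in> {0..1} \<Longrightarrow> t \<in> {0..1} \<Longrightarrow> dist (\<gamma> s) (\<gamma> t) \<le> K * \<bar>s - t\<bar>"
proof -
  define l where "l = arclen a e"
  have l: "l > 0"
  proof -
    have "0 < dist a e" using ne by simp
    then show ?thesis
      using arclen_lower[OF chain le_base le_refl] arclen_base[OF chain] unfolding l_def by linarith
  qed
  have inj: "inj_on (arclen a) (interval a e)"
    using arclen_bilipschitz(1)[OF chain] by (intro inj_onI) fastforce
  \<comment> \<open>The inverse of arc length, rescaled from \<open>{0..l}\<close> to the unit
    interval.\<close>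
  define \<gamma> where "\<gamma> t = the_inv_into (interval a e) (arclen a) (t * l)" for t
  have scale: "(\<lambda>t. t * l) ` {0..1} = {0..l}"
    using l image_mult_atLeastAtMost[of l 0 1] by (simp add: mult.commute)
  have in_img: "t * l \<in> arclen a ` interval a e" if "t \<in> {0..1}" for t
    using that scale arclen_image[OF chain] unfolding l_def by blast
  have \<gamma>_in: "\<gamma> t \<in> interval a e" if "t \<in> {0..1}" for t
    unfolding \<gamma>_def using the_inv_into_into[OF inj in_img[OF that]] by simp
  have \<gamma>_len: "arclen a (\<gamma> t) = t * l" if "t \<in> {0..1}" for t
    unfolding \<gamma>_def by (rule f_the_inv_into_f[OF inj in_img[OF that]])
  have \<gamma>_img: "\<gamma> ` {0..1} = interval a e"
  proof -
    have "\<gamma> ` {0..1} = the_inv_into (interval a e) (arclen a) ` (\<lambda>t. t * l) ` {0..1}"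
      by (auto simp: \<gamma>_def image_image)
    also have "\<dots> = the_inv_into (interval a e) (arclen a) ` arclen a ` interval a e"
      using scale arclen_image[OF chain] by (simp add: l_def)
    also have "\<dots> = interval a e" by (rule the_inv_into_onto[OF inj])
    finally show ?thesis .
  qed
  \<comment> \<open>Increasing parameters give increasing points, whose median is the middle one by
    \<open>le_between\<close>. The other orders of the arguments follow by symmetry.\<close>
  have sorted: "\<mu> (\<gamma> s) (\<gamma> t) (\<gamma> u) = \<gamma> t" if "{s,t,u} \<subseteq> {0..1}" "s \<le> t" "t \<le> u" for s t u
    using that l \<gamma>_len by (intro le_between[of a] le_arclen[OF chain] \<gamma>_in) auto
  have mid: "\<gamma> (middle s t u) = \<mu> (\<gamma> s) (\<gamma> t) (\<gamma> u)" if "{s,t,u} \<subseteq> {0..1}" for s t u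
  proof -
    consider "s \<le> t" "t \<le> u" | "s \<le> u" "u \<le> t" | "t \<le> s" "s \<le> u" | "t \<le> u" "u \<le> s"
      | "u \<le> s" "s \<le> t" | "u \<le> t" "t \<le> s" by linarith
    then show ?thesis
    proof cases
      case 1 then show ?thesis using sorted[of s t u] that by (simp add: middle_def)
    next
      case 2 then show ?thesis using sorted[of s u t] that by (simp add: middle_def perm)
    next
      case 3 then show ?thesis using sorted[of t s u] that by (simp add: middle_def perm)
    next
      case 4 then show ?thesis using sorted[of t u s] that by (simp add: middle_def perm)
    next
      case 5 then show ?thesis using sorted[of u s t] that by (simp add: middle_def perm)
    next
      case 6 then show ?thesis using sorted[of u t s] that by (simp add: middle_def perm)
    qed
  qed
  \<comment> \<open>\<open>l\<close> bounds the stretching of \<open>\<gamma>\<close>, and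
    \<open>k / l\<close> that of its inverse.\<close>
  define K where "K = max 1 (max (k / l) l)"
  show ?thesis
  proof (rule that[of K \<gamma>])
    fix s t :: real assume st: "s \<in> {0..1}" "t \<in> {0..1}"
    have eq: "\<bar>arclen a (\<gamma> s) - arclen a (\<gamma> t)\<bar> = \<bar>s - t\<bar> * l"
      using l by (simp add: \<gamma>_len[OF st(1)] \<gamma>_len[OF st(2)] abs_mult flip: left_diff_distrib)
    have "\<bar>s - t\<bar> * l \<le> k * dist (\<gamma> s) (\<gamma> t)"
      using arclen_bilipschitz(2)[OF chain \<gamma>_in[OF st(1)] \<gamma>_in[OF st(2)]] by (simp add: eq)
    then have "\<bar>s - t\<bar> \<le> k / l * dist (\<gamma> s) (\<gamma> t)"
      using l by (simp add: field_simps)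
    also have "\<dots> \<le> K * dist (\<gamma> s) (\<gamma> t)"
      by (intro mult_right_mono) (auto simp: K_def)
    finally show "\<bar>s - t\<bar> \<le> K * dist (\<gamma> s) (\<gamma> t)" .
    have "dist (\<gamma> s) (\<gamma> t) \<le> l * \<bar>s - t\<bar>"
      using arclen_bilipschitz(1)[OF chain \<gamma>_in[OF st(1)] \<gamma>_in[OF st(2)]] by (simp add: eq mult.commute)
    also have "\<dots> \<le> K * \<bar>s - t\<bar>"
      by (intro mult_right_mono) (auto simp: K_def)
    finally show "dist (\<gamma> s) (\<gamma> t) \<le> K * \<bar>s - t\<bar>" .
  qed (use mid \<gamma>_img in \<open>auto simp: K_def\<close>)
qed

text \<open>The map joins the points given by the arcs on the edges. The projections
  \<open>\<mu> a (e i)\<close> recover these points, which yields injectivity, surjectivity onto the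
  interval and the lower Lipschitz bound.\<close>

lemma cube_parametrization:
  assumes fr: "frame a e b r" and ne: "\<And>i. i < r \<Longrightarrow> e i \<noteq> a" and chain: "\<And>i. i < r \<Longrightarrow> chain a (e i)"
  shows "\<exists>f. median_embedding (unit_cube r) (cube_median r) UNIV \<mu> f \<and>
           biLipschitz_on (unit_cube r) (cube_dist r) dist f \<and> f ` unit_cube r = interval a (b r)"
proof -
  \<comment> \<open>The properties of an arc are bundled so that arcs and constants can be chosen
    for all edges at once.\<close>
  define good where "good i \<gamma> K \<longleftrightarrow> K \<ge> 1 \<and> \<gamma> ` {0..1} = interval a (e i) \<and>
      (\<forall>s\<in>{0..1}. \<forall>t\<in>{0..1}. \<forall>u\<in>{0..1}. \<gamma> (middle s t u) = \<mu> (\<gamma> s) (\<gamma> t) (\<gamma> u)) \<and>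
      (\<forall>s\<in>{0..1}. \<forall>t\<in>{0..1}. \<bar>s - t\<bar> \<le> K * dist (\<gamma> s) (\<gamma> t) \<and> dist (\<gamma> s) (\<gamma> t) \<le> K * \<bar>s - t\<bar>)"
    for i K and \<gamma> :: "real \<Rightarrow> 'a"
  have "\<exists>\<gamma> K. good i \<gamma> K" if "i < r" for i
  proof (rule arc_parametrization[OF chain[OF that] ne[OF that]])
    fix \<gamma> K
    assume "1 \<le> K" "\<gamma> ` {0..1} = interval a (e i)"
      "\<And>s t u. s \<in> {0..1} \<Longrightarrow> t \<in> {0..1} \<Longrightarrow> u \<in> {0..1} \<Longrightarrow> \<gamma> (middle s t u) = \<mu> (\<gamma> s) (\<gamma> t) (\<gamma> u)"
      "\<And>s t. s \<in> {0..1} \<Longrightarrow> t \<in> {0..1} \<Longrightarrow> \<bar>s - t\<bar> \<le> K * dist (\<gamma> s) (\<gamma> t)"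
      "\<And>s t. s \<in> {0..1} \<Longrightarrow> t \<in> {0..1} \<Longrightarrow> dist (\<gamma> s) (\<gamma> t) \<le> K * \<bar>s - t\<bar>"
    then have "good i \<gamma> K" unfolding good_def by blast
    then show ?thesis by blast
  qed
  then obtain \<gamma> K where gK: "\<And>i. i < r \<Longrightarrow> good i (\<gamma> i) (K i)" by metis
  \<comment> \<open>A common constant for all arcs; the summand 1 keeps it at least 1 also when
    \<open>r = 0\<close>.\<close>
  define M where "M = 1 + (\<Sum>i<r. K i)"
  have K1: "1 \<le> K i" if "i < r" for i using gK[OF that] by (simp add: good_def)
  have KM: "K i \<le> M" if "i < r" for i
  proof -
    have "K i \<le> (\<Sum>i<r. K i)" using that K1 by (intro member_le_sum) (auto intro: order_trans[of 0 1])
    then show ?thesis by (simp add: M_def)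
  qed
  have M1: "1 \<le> M"
  proof -
    have "0 \<le> (\<Sum>i<r. K i)" using order_trans[OF zero_le_one K1] by (intro sum_nonneg) simp
    then show ?thesis by (simp add: M_def)
  qed
  obtain C where C: "C \<ge> 0" "\<And>x y. dist (join a b x r) (join a b y r) \<le> C * (\<Sum>i<r. dist (x i) (y i))"
    using join_Lipschitz by metis
  define p where "p t i = \<gamma> i (t i)" for t :: "nat \<Rightarrow> real" and i
  define f where "f t = join a b (p t) r" for t
  have coord: "t i \<in> {0..1}" if "t \<in> unit_cube r" "i < r" for t i
    using that unfolding unit_cube_def by (meson PiE_mem lessThan_iff)
  have p_in: "p t i \<in> interval a (e i)" if "t \<in> unit_cube r" "i < r" for t i
    using gK[OF that(2)] coord[OF that] unfolding p_def good_def by blast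
  have proj: "\<mu> a (e i) (f t) = p t i" if "t \<in> unit_cube r" "i < r" for t i
    unfolding f_def using proj_join[OF fr p_in[OF that(1)] that(2)] .
  have lower: "\<bar>s i - t i\<bar> \<le> M * (k * dist (f s) (f t))"
    if "s \<in> unit_cube r" "t \<in> unit_cube r" "i < r" for s t i
  proof -
    have "\<bar>s i - t i\<bar> \<le> K i * dist (p s i) (p t i)"
      using gK[OF that(3)] coord[OF that(1,3)] coord[OF that(2,3)] unfolding good_def p_def by blast
    also have "\<dots> \<le> M * dist (p s i) (p t i)"
      using KM[OF that(3)] by (rule mult_right_mono) simp
    also have "\<dots> \<le> M * (k * dist (f s) (f t))"
      using proj_Lipschitz[of a "e i" "f s" "f t"] M1 proj that
      by (intro mult_left_mono) auto
    finally show ?thesis .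
  qed
  have cube_dist_ge: "\<bar>s i - t i\<bar> \<le> cube_dist r s t" if "i < r" for s t i
    using member_le_L2_set[of "{..<r}" i "\<lambda>i. dist (s i) (t i)"] that
    by (simp add: cube_dist_def dist_real_def)
  have cube_dist_le: "cube_dist r s t \<le> (\<Sum>i<r. \<bar>s i - t i\<bar>)" for s t
    using L2_set_le_sum[of "{..<r}" "\<lambda>i. dist (s i) (t i)"]
    by (simp add: cube_dist_def dist_real_def)
  \<comment> \<open>The second summand serves the upper estimate, through \<open>C\<close> and the
    arcs; the third serves the lower one, summed over the coordinates.\<close>
  define D where "D = 1 + C * (real r * M) + real r * (M * k)"
  have rM: "0 \<le> C * (real r * M)" "0 \<le> real r * (M * k)"
    using C(1) M1 k_ge_1 by auto
  have D1: "1 \<le> D" using rM by (simp add: D_def)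
  have dist_le: "dist (f s) (f t) \<le> D * cube_dist r s t"
    and dist_ge: "cube_dist r s t / D \<le> dist (f s) (f t)"
    if st: "s \<in> unit_cube r" "t \<in> unit_cube r" for s t
  proof -
    have cd: "0 \<le> cube_dist r s t" by (simp add: cube_dist_def L2_set_nonneg)
    have "dist (p s i) (p t i) \<le> M * cube_dist r s t" if i: "i < r" for i
    proof -
      have "dist (p s i) (p t i) \<le> K i * \<bar>s i - t i\<bar>"
        using gK[OF i] coord[OF st(1) i] coord[OF st(2) i] unfolding good_def p_def by blast
      also have "\<dots> \<le> M * cube_dist r s t"
        using KM[OF i] M1 cube_dist_ge[OF i] by (intro mult_mono) auto
      finally show ?thesis .
    qed
    then have "(\<Sum>i<r. dist (p s i) (p t i)) \<le> real r * (M * cube_dist r s t)"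
      using sum_bounded_above[of "{..<r}" "\<lambda>i. dist (p s i) (p t i)" "M * cube_dist r s t"] by simp
    then have "dist (f s) (f t) \<le> C * (real r * (M * cube_dist r s t))"
      unfolding f_def using C(2)[of "p s" "p t"] C(1) by (meson mult_left_mono order_trans)
    also have "\<dots> = (C * (real r * M)) * cube_dist r s t" by simp
    also have "\<dots> \<le> D * cube_dist r s t"
      using cd rM by (intro mult_right_mono) (auto simp: D_def)
    finally show "dist (f s) (f t) \<le> D * cube_dist r s t" .
    have "cube_dist r s t \<le> real r * (M * (k * dist (f s) (f t)))"
      using cube_dist_le[of s t] lower[OF st]
        sum_bounded_above[of "{..<r}" "\<lambda>i. \<bar>s i - t i\<bar>" "M * (k * dist (f s) (f t))"] by simp
    also have "\<dots> = (real r * (M * k)) * dist (f s) (f t)" by simp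
    also have "\<dots> \<le> D * dist (f s) (f t)"
      using rM by (intro mult_right_mono) (auto simp: D_def)
    finally show "cube_dist r s t / D \<le> dist (f s) (f t)"
      using D1 by (simp add: divide_le_eq mult.commute)
  qed
  have "inj_on f (unit_cube r)"
  proof (rule inj_onI)
    fix s t assume st: "s \<in> unit_cube r" "t \<in> unit_cube r" "f s = f t"
    have "s i = t i" if "i \<in> {..<r}" for i
      using lower[OF st(1,2), of i] that st(3) by simp
    then show "s = t" using st(1,2) unfolding unit_cube_def by (metis PiE_ext)
  qed
  moreover have "f (cube_median r s t u) = \<mu> (f s) (f t) (f u)"
    if stu: "s \<in> unit_cube r" "t \<in> unit_cube r" "u \<in> unit_cube r" for s t u
  proof -
    have m: "cube_median r s t u \<in> unit_cube r"
      using median_on_unit_cube[of r] stu unfolding median_on_def by blast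
    have "\<mu> (p s i) (p t i) (p u i) = p (cube_median r s t u) i" if i: "i < r" for i
      using gK[OF i] coord[OF stu(1) i] coord[OF stu(2) i] coord[OF stu(3) i] i
      by (simp add: good_def p_def cube_median_def)
    then show ?thesis
      unfolding f_def using stu m
      by (intro join_unique[OF fr p_in] median_in_interval join_in[OF fr p_in])
        (simp_all add: proj_median proj_join[OF fr p_in])
  qed
  ultimately have "median_embedding (unit_cube r) (cube_median r) UNIV \<mu> f"
    by (simp add: median_embedding_def median_map_def)
  moreover have "biLipschitz_on (unit_cube r) (cube_dist r) dist f"
    unfolding biLipschitz_on_def using D1 dist_le dist_ge by blast
  moreover have "f ` unit_cube r = interval a (b r)"
  proof
    show "f ` unit_cube r \<subseteq> interval a (b r)"
      using join_in[OF fr p_in] by (auto simp: f_def)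
    show "interval a (b r) \<subseteq> f ` unit_cube r"
    proof
      fix z assume z: "z \<in> interval a (b r)"
      \<comment> \<open>Each coordinate of \<open>z\<close> lies on its arc, and
        \<open>join_unique\<close> reassembles \<open>z\<close> from them.\<close>
      have "\<exists>t\<in>{0..1}. \<gamma> i t = \<mu> a (e i) z" if "i < r" for i
        using gK[OF that] proj_in_interval[of a "e i" z] unfolding good_def by (metis imageE)
      then obtain \<tau> where \<tau>: "\<And>i. i < r \<Longrightarrow> \<tau> i \<in> {0..1} \<and> \<gamma> i (\<tau> i) = \<mu> a (e i) z" by metis
      define t where "t = restrict \<tau> {..<r}"
      have t: "t \<in> unit_cube r" using \<tau> by (auto simp: t_def unit_cube_def)
      have "f t = z"
        unfolding f_def using z \<tau> by (intro join_unique[OF fr p_in[OF t]]) (auto simp: p_def t_def)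
      then show "z \<in> f ` unit_cube r" using t by blast
    qed
  qed
  ultimately show ?thesis by blast
qed

end

theorem proposition7:
  fixes \<mu> :: "'a::metric_space \<Rightarrow> 'a \<Rightarrow> 'a \<Rightarrow> 'a" and r :: nat
  assumes "geodesic_set (UNIV :: 'a set)"
    and "median_on UNIV \<mu>"
    and "Lipschitz_median UNIV \<mu>"
    and "locally_convex_median UNIV \<mu>"
    and "median_rank UNIV \<mu> r"
  shows "\<exists>f :: (nat \<Rightarrow> real) \<Rightarrow> 'a.
           median_embedding (unit_cube r) (cube_median r) UNIV \<mu> f \<and>
           biLipschitz_on (unit_cube r) (cube_dist r) dist f \<and>
           median_convex UNIV \<mu> (f ` unit_cube r)"
proof -
  obtain k where k: "\<And>a b c a' b' c'. dist (\<mu> a b c) (\<mu> a' b' c') \<le> k * (dist a a' + dist b b' + dist c c')"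
    using assms(3) unfolding Lipschitz_median_def by blast
  \<comment> \<open>A Lipschitz constant may be enlarged, so it can be taken to be at least 1, as
    the locale asks.\<close>
  have "dist (\<mu> a b c) (\<mu> a' b' c') \<le> max 1 k * (dist a a' + dist b b' + dist c c')" for a b c a' b' c'
    by (rule order_trans[OF k]) (intro mult_right_mono, auto)
  then interpret lipschitz_median \<mu> "max 1 k"
    using assms(1,2) by unfold_locales auto
  obtain f where "median_embedding (discrete_cube r) (cube_median r) UNIV \<mu> f"
    and rank: "\<And>n f. median_embedding (discrete_cube n) (cube_median n) UNIV \<mu> f \<Longrightarrow> n \<le> r"
    using assms(5) unfolding median_rank_def by blast
  then obtain a e b where fr: "frame a e b r" and ne: "\<And>i. i < r \<Longrightarrow> e i \<noteq> a"
    using frame_of_cube by metis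
  have "chain a (e i)" if "i < r" for i
    unfolding chain_def by (intro ballI edge_chain[OF fr ne rank that])
  \<comment> \<open>The image is the whole interval from \<open>a\<close> to \<open>b r\<close>,
    hence convex.\<close>
  from cube_parametrization[OF fr ne this] show ?thesis
    using convex_interval by metis
qed

end
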